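(* Let $(\alpha,\beta,t)$ be an admissible triple with $\alpha>0$ (see context), let $p_n,r_n,q_n$ ($n\in\mathbb{Z}$) be the associated coefficients and $P$ the associated doubly infinite stochastic tridiagonal matrix. Then the continued fractions $H$ and $H'$ converge and $$H=H'=\frac{\alpha+t}{\alpha+\beta+2t+1},$$ and there exists only one value of the parameter $\tilde t_0$, namely $\tilde t_0=H$, for which one obtains a stochastic LU factorization $P=\widetilde P_L\widetilde P_U$. The coefficients of the factors $\widetilde P_L$ and $\widetilde P_U$ are given by $$\tilde y_n=t_{n+1},\qquad \tilde x_n=s_{n+1},\qquad \tilde s_n=x_n,\qquad \tilde t_n=y_n,\qquad n\in\mathbb{Z},$$ where, for $n\in\mathbb{Z}$, $$y_n=\frac{n+t+\alpha}{2n+2t+\alpha+\beta+1},\quad x_n=\frac{n+t+\beta+1}{2n+2t+\alpha+\beta+1},\quad s_n=\frac{n+t+\alpha+\beta}{2n+2t+\alpha+\beta},\quad t_n=\frac{n+t}{2n+2t+\alpha+\beta}.$$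
   Context: Admissible triples with $\alpha>0$: $0<\alpha<1$, $-1<\beta<0$, $t\in\mathbb{R}$, and one of the following holds: (A1) $\beta-\alpha+1>0$, $\alpha>-\beta$, and $t\in\bigcup_{n\in\mathbb{Z}}(n,n-\beta)\cup(n-\alpha,n-\alpha-\beta)$; (A2) $\beta-\alpha+1>0$, $\alpha<-\beta$, and $t\in\bigcup_{n\in\mathbb{Z}}(n-\alpha,n)\cup(n-\alpha-\beta,n-\beta)$; (B1) $\beta-\alpha+1<0$, $\alpha>-\beta$, and $t\in\bigcup_{n\in\mathbb{Z}}(n,n-\alpha+1)\cup(n-\beta,n-\alpha-\beta+1)$; (B2) $\beta-\alpha+1<0$, $\alpha<-\beta$, and $t\in\bigcup_{n\in\mathbb{Z}}(n-\beta-1,n)\cup(n-\alpha-\beta,n-\alpha+1)$. Coefficients: for $n\in\mathbb{Z}$, $$p_n=\frac{(n+t+\beta+1)(n+t+\alpha+\beta+1)}{(2n+2t+\alpha+\beta+1)(2n+2t+\alpha+\beta+2)},\qquad q_n=\frac{(n+t)(n+t+\alpha)}{(2n+2t+\alpha+\beta)(2n+2t+\alpha+\beta+1)},$$ $$r_n=\frac{(n+t+\beta+1)(n+t+1)}{(2n+2t+\alpha+\beta+1)(2n+2t+\alpha+\beta+2)}+\frac{(n+t+\alpha)(n+t+\alpha+\beta)}{(2n+2t+\alpha+\beta)(2n+2t+\alpha+\beta+1)}.$$ For admissible triples these are all positive and $p_n+r_n+q_n=1$. $P=(P_{i,j})_{i,j\in\mathbb{Z}}$ is the doubly infinite tridiagonal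 matrix with $P_{n,n+1}=p_n$, $P_{n,n}=r_n$, $P_{n,n-1}=q_n$ and all other entries $0$. Stochastic LU factorization: $P=\widetilde P_L\widetilde P_U$, where $\widetilde P_L$ is doubly infinite lower bidiagonal with $(\widetilde P_L)_{n,n}=\tilde s_n$, $(\widetilde P_L)_{n,n-1}=\tilde t_n$ and $\widetilde P_U$ is doubly infinite upper bidiagonal with $(\widetilde P_U)_{n,n}=\tilde y_n$, $(\widetilde P_U)_{n,n+1}=\tilde x_n$ (all other entries $0$), all entries are nonnegative, and $\tilde t_n+\tilde s_n=1$, $\tilde y_n+\tilde x_n=1$ for all $n\in\mathbb{Z}$. Equivalently $p_n=\tilde s_n\tilde x_n$, $r_n=\tilde t_n\tilde x_{n-1}+\tilde s_n\tilde y_n$, $q_n=\tilde t_n\tilde y_{n-1}$ for all $n\in\mathbb{Z}$. The sequences are determined recursively by the single free parameter $\tilde t_0$. (The sequences $(t_n)$, $(\tilde t_n)$ are not to be confused with the real parameter $t$.) Continued fractions (values are limits of the convergents): $$H=1-\cfrac{p_0}{1-\cfrac{q_1}{1-\cfrac{p_1}{1-\cfrac{q_2}{1-\cdots}}}},\qquad H'=\cfrac{q_0}{1-\cfrac{p_{-1}}{1-\cfrac{q_{-1}}{1-\cfrac{p_{-2}}{1-\cdots}}}}.$$ *)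

theory Defs
  imports "HOL-Analysis.Analysis"
begin

section \<open>Continued fractions\<close>

text \<open>
  The continued fraction b0 + a 0 / (b 0 + a 1 / (b 1 + a 2 / (b 2 + ...))) is given by the
  sequences \<open>a\<close> of partial numerators and \<open>b\<close> of partial denominators.  Its \<open>n\<close>-th convergent is
  \<open>cf_num b0 a b n / cf_den a b n\<close>, by the fundamental (Wallis--Euler) recurrence; the lemma
  \<open>cf_convergent_eq_nested\<close> below identifies it with the truncated nested fraction.
\<close>

fun cf_num :: "real \<Rightarrow> (nat \<Rightarrow> real) \<Rightarrow> (nat \<Rightarrow> real) \<Rightarrow> nat \<Rightarrow> real" where
  "cf_num b0 a b 0 = b0"
| "cf_num b0 a b (Suc 0) = b 0 * b0 + a 0"
| "cf_num b0 a b (Suc (Suc n)) =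
     b (Suc n) * cf_num b0 a b (Suc n) + a (Suc n) * cf_num b0 a b n"

fun cf_den :: "(nat \<Rightarrow> real) \<Rightarrow> (nat \<Rightarrow> real) \<Rightarrow> nat \<Rightarrow> real" where
  "cf_den a b 0 = 1"
| "cf_den a b (Suc 0) = b 0"
| "cf_den a b (Suc (Suc n)) = b (Suc n) * cf_den a b (Suc n) + a (Suc n) * cf_den a b n"

definition cf_convergent :: "real \<Rightarrow> (nat \<Rightarrow> real) \<Rightarrow> (nat \<Rightarrow> real) \<Rightarrow> nat \<Rightarrow> real" where
  "cf_convergent b0 a b n = cf_num b0 a b n / cf_den a b n"

text \<open>At most finitely many convergents are undefined, and the others have a finite limit.\<close>

definition cf_converges :: "real \<Rightarrow> (nat \<Rightarrow> real) \<Rightarrow> (nat \<Rightarrow> real) \<Rightarrow> bool" where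
  "cf_converges b0 a b \<longleftrightarrow>
     (\<forall>\<^sub>F n in sequentially. cf_den a b n \<noteq> 0) \<and> convergent (cf_convergent b0 a b)"

definition cf_value :: "real \<Rightarrow> (nat \<Rightarrow> real) \<Rightarrow> (nat \<Rightarrow> real) \<Rightarrow> real" where
  "cf_value b0 a b = lim (cf_convergent b0 a b)"

fun cf_nested :: "real \<Rightarrow> (nat \<Rightarrow> real) \<Rightarrow> (nat \<Rightarrow> real) \<Rightarrow> nat \<Rightarrow> real" where
  "cf_nested b0 a b 0 = b0"
| "cf_nested b0 a b (Suc n) = b0 + a 0 / cf_nested (b 0) (\<lambda>k. a (Suc k)) (\<lambda>k. b (Suc k)) n"

lemma cf_shift:
  "cf_den a b (Suc n) = cf_num (b 0) (\<lambda>k. a (Suc k)) (\<lambda>k. b (Suc k)) n"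
  "cf_num b0 a b (Suc n) =
     b0 * cf_num (b 0) (\<lambda>k. a (Suc k)) (\<lambda>k. b (Suc k)) n
     + a 0 * cf_den (\<lambda>k. a (Suc k)) (\<lambda>k. b (Suc k)) n"
proof -
  have "cf_den a b (Suc n) = cf_num (b 0) (\<lambda>k. a (Suc k)) (\<lambda>k. b (Suc k)) n \<and>
     cf_num b0 a b (Suc n) =
     b0 * cf_num (b 0) (\<lambda>k. a (Suc k)) (\<lambda>k. b (Suc k)) n
     + a 0 * cf_den (\<lambda>k. a (Suc k)) (\<lambda>k. b (Suc k)) n"
    by (induction n rule: cf_den.induct[of _ a b]) (auto simp: algebra_simps)
  then show "cf_den a b (Suc n) = cf_num (b 0) (\<lambda>k. a (Suc k)) (\<lambda>k. b (Suc k)) n"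
    and "cf_num b0 a b (Suc n) =
     b0 * cf_num (b 0) (\<lambda>k. a (Suc k)) (\<lambda>k. b (Suc k)) n
     + a 0 * cf_den (\<lambda>k. a (Suc k)) (\<lambda>k. b (Suc k)) n"
    by blast+
qed

lemma cf_convergent_eq_nested:
  assumes "\<And>j m. cf_nested (b j) (\<lambda>k. a (Suc (j + k))) (\<lambda>k. b (Suc (j + k))) m \<noteq> 0"
  shows "cf_den a b n \<noteq> 0 \<and> cf_convergent b0 a b n = cf_nested b0 a b n"
  using assms
proof (induction n arbitrary: b0 a b)
  case 0
  then show ?case by (simp add: cf_convergent_def)
next
  case (Suc n)
  let ?a = "\<lambda>k. a (Suc k)" and ?b = "\<lambda>k. b (Suc k)"
  have "\<And>j m. cf_nested (?b j) (\<lambda>k. ?a (Suc (j + k))) (\<lambda>k. ?b (Suc (j + k))) m \<noteq> 0"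
    using Suc.prems[of "Suc _"] by simp
  note IH = Suc.IH[of ?b ?a "b 0", OF this]
  have "cf_nested (b 0) ?a ?b n \<noteq> 0"
    using Suc.prems[of 0 n] by simp
  with IH have "cf_num (b 0) ?a ?b n \<noteq> 0"
    by (auto simp: cf_convergent_def)
  with IH show ?case
    by (auto simp: cf_convergent_def cf_shift field_simps simp del: cf_num.simps(2,3) cf_den.simps(2,3))
qed


section \<open>The parameters and the coefficients\<close>

definition admissible_pos :: "real \<Rightarrow> real \<Rightarrow> real \<Rightarrow> bool" where
  "admissible_pos \<alpha> \<beta> t \<longleftrightarrow>
     0 < \<alpha> \<and> \<alpha> < 1 \<and> -1 < \<beta> \<and> \<beta> < 0 \<and>
     ((\<beta> - \<alpha> + 1 > 0 \<and> \<alpha> > -\<beta> \<and>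
         t \<in> (\<Union>n::int. {of_int n <..< of_int n - \<beta>}
                      \<union> {of_int n - \<alpha> <..< of_int n - \<alpha> - \<beta>})) \<or>
      (\<beta> - \<alpha> + 1 > 0 \<and> \<alpha> < -\<beta> \<and>
         t \<in> (\<Union>n::int. {of_int n - \<alpha> <..< of_int n}
                      \<union> {of_int n - \<alpha> - \<beta> <..< of_int n - \<beta>})) \<or>
      (\<beta> - \<alpha> + 1 < 0 \<and> \<alpha> > -\<beta> \<and>
         t \<in> (\<Union>n::int. {of_int n <..< of_int n - \<alpha> + 1}
                      \<union> {of_int n - \<beta> <..< of_int n - \<alpha> - \<beta> + 1})) \<or>
      (\<beta> - \<alpha> + 1 < 0 \<and> \<alpha> < -\<beta> \<and>
         t \<in> (\<Union>n::int. {of_int n - \<beta> - 1 <..< of_int n}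
                      \<union> {of_int n - \<alpha> - \<beta> <..< of_int n - \<alpha> + 1})))"

definition p_coeff :: "real \<Rightarrow> real \<Rightarrow> real \<Rightarrow> int \<Rightarrow> real" where
  "p_coeff \<alpha> \<beta> t n =
     ((of_int n + t + \<beta> + 1) * (of_int n + t + \<alpha> + \<beta> + 1)) /
     ((2 * of_int n + 2 * t + \<alpha> + \<beta> + 1) * (2 * of_int n + 2 * t + \<alpha> + \<beta> + 2))"

definition q_coeff :: "real \<Rightarrow> real \<Rightarrow> real \<Rightarrow> int \<Rightarrow> real" where
  "q_coeff \<alpha> \<beta> t n =
     ((of_int n + t) * (of_int n + t + \<alpha>)) /
     ((2 * of_int n + 2 * t + \<alpha> + \<beta>) * (2 * of_int n + 2 * t + \<alpha> + \<beta> + 1))"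

definition r_coeff :: "real \<Rightarrow> real \<Rightarrow> real \<Rightarrow> int \<Rightarrow> real" where
  "r_coeff \<alpha> \<beta> t n =
     ((of_int n + t + \<beta> + 1) * (of_int n + t + 1)) /
     ((2 * of_int n + 2 * t + \<alpha> + \<beta> + 1) * (2 * of_int n + 2 * t + \<alpha> + \<beta> + 2)) +
     ((of_int n + t + \<alpha>) * (of_int n + t + \<alpha> + \<beta>)) /
     ((2 * of_int n + 2 * t + \<alpha> + \<beta>) * (2 * of_int n + 2 * t + \<alpha> + \<beta> + 1))"

definition y_coeff :: "real \<Rightarrow> real \<Rightarrow> real \<Rightarrow> int \<Rightarrow> real" where
  "y_coeff \<alpha> \<beta> t n = (of_int n + t + \<alpha>) / (2 * of_int n + 2 * t + \<alpha> + \<beta> + 1)"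

definition x_coeff :: "real \<Rightarrow> real \<Rightarrow> real \<Rightarrow> int \<Rightarrow> real" where
  "x_coeff \<alpha> \<beta> t n = (of_int n + t + \<beta> + 1) / (2 * of_int n + 2 * t + \<alpha> + \<beta> + 1)"

definition s_coeff :: "real \<Rightarrow> real \<Rightarrow> real \<Rightarrow> int \<Rightarrow> real" where
  "s_coeff \<alpha> \<beta> t n = (of_int n + t + \<alpha> + \<beta>) / (2 * of_int n + 2 * t + \<alpha> + \<beta>)"

definition t_coeff :: "real \<Rightarrow> real \<Rightarrow> real \<Rightarrow> int \<Rightarrow> real" where
  "t_coeff \<alpha> \<beta> t n = (of_int n + t) / (2 * of_int n + 2 * t + \<alpha> + \<beta>)"


section \<open>Doubly infinite matrices and stochastic LU factorizations\<close>

type_synonym bi_matrix = "int \<Rightarrow> int \<Rightarrow> real"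

definition P_mat :: "real \<Rightarrow> real \<Rightarrow> real \<Rightarrow> bi_matrix" where
  "P_mat \<alpha> \<beta> t i j =
     (if j = i + 1 then p_coeff \<alpha> \<beta> t i
      else if j = i then r_coeff \<alpha> \<beta> t i
      else if j = i - 1 then q_coeff \<alpha> \<beta> t i
      else 0)"

text \<open>For banded factors, the only ones used here, each entry is a sum with finitely many nonzero terms.\<close>

definition bi_mult :: "bi_matrix \<Rightarrow> bi_matrix \<Rightarrow> bi_matrix" where
  "bi_mult A B i j = (\<Sum>\<^sub>\<infinity>k\<in>UNIV. A i k * B k j)"

definition lower_bidiagonal :: "bi_matrix \<Rightarrow> bool" where
  "lower_bidiagonal A \<longleftrightarrow> (\<forall>i j. j \<noteq> i \<and> j \<noteq> i - 1 \<longrightarrow> A i j = 0)"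

definition upper_bidiagonal :: "bi_matrix \<Rightarrow> bool" where
  "upper_bidiagonal A \<longleftrightarrow> (\<forall>i j. j \<noteq> i \<and> j \<noteq> i + 1 \<longrightarrow> A i j = 0)"

definition stochastic_LU :: "bi_matrix \<Rightarrow> bi_matrix \<Rightarrow> bi_matrix \<Rightarrow> bool" where
  "stochastic_LU P L U \<longleftrightarrow>
     lower_bidiagonal L \<and> upper_bidiagonal U \<and>
     (\<forall>i j. L i j \<ge> 0) \<and> (\<forall>i j. U i j \<ge> 0) \<and>
     (\<forall>n. L n (n - 1) + L n n = 1) \<and> (\<forall>n. U n n + U n (n + 1) = 1) \<and>
     P = bi_mult L U"


section \<open>The continued fractions \<open>H\<close> and \<open>H'\<close>\<close>

text \<open>
  Partial numerators of \<open>H\<close>: -p(0), -q(1), -p(1), -q(2), ...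
  Partial numerators of \<open>H'\<close>: q(0), -p(-1), -q(-1), -p(-2), -q(-2), ...
  All partial denominators are 1; the leading terms are 1 and 0, respectively.
\<close>

definition H_num :: "real \<Rightarrow> real \<Rightarrow> real \<Rightarrow> nat \<Rightarrow> real" where
  "H_num \<alpha> \<beta> t k =
     (if even k then - p_coeff \<alpha> \<beta> t (int (k div 2))
      else - q_coeff \<alpha> \<beta> t (int (k div 2) + 1))"

definition H'_num :: "real \<Rightarrow> real \<Rightarrow> real \<Rightarrow> nat \<Rightarrow> real" where
  "H'_num \<alpha> \<beta> t k =
     (if k = 0 then q_coeff \<alpha> \<beta> t 0
      else if odd k then - p_coeff \<alpha> \<beta> t (- int (k div 2) - 1)
      else - q_coeff \<alpha> \<beta> t (- int (k div 2)))"

definition H_converges :: "real \<Rightarrow> real \<Rightarrow> real \<Rightarrow> bool" where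
  "H_converges \<alpha> \<beta> t \<longleftrightarrow> cf_converges 1 (H_num \<alpha> \<beta> t) (\<lambda>_. 1)"

definition H'_converges :: "real \<Rightarrow> real \<Rightarrow> real \<Rightarrow> bool" where
  "H'_converges \<alpha> \<beta> t \<longleftrightarrow> cf_converges 0 (H'_num \<alpha> \<beta> t) (\<lambda>_. 1)"

definition H_val :: "real \<Rightarrow> real \<Rightarrow> real \<Rightarrow> real" where
  "H_val \<alpha> \<beta> t = cf_value 1 (H_num \<alpha> \<beta> t) (\<lambda>_. 1)"

definition H'_val :: "real \<Rightarrow> real \<Rightarrow> real \<Rightarrow> real" where
  "H'_val \<alpha> \<beta> t = cf_value 0 (H'_num \<alpha> \<beta> t) (\<lambda>_. 1)"

end

theory Submission
  imports Defs "HOL-Real_Asymp.Real_Asymp"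
begin

text \<open>
  Factoring \<open>P\<close> into stochastic bidiagonal matrices means writing its off-diagonal entries as a
  chain sequence.  Read upwards from row \<open>m\<close>, the numbers
  \<open>h 0 = L m (m-1)\<close>, \<open>h 1 = U m (m+1)\<close>, \<open>h 2 = L (m+1) m\<close>, \<dots> lie in \<open>[0,1]\<close> and satisfy
  \<open>(1 - h k) * h (k+1) = p m, q (m+1), p (m+1), \<dots>\<close>.  Read downwards,
  \<open>U (m-1) (m-1)\<close>, \<open>L (m-1) (m-1)\<close>, \<open>U (m-2) (m-2)\<close>, \<dots> satisfy the same relation with
  \<open>p (m-1), q (m-1), p (m-2), \<dots>\<close>.  For \<open>m = 0\<close> these two chain sequences are, up to sign, the
  partial numerators of \<open>H\<close> and of the tail of \<open>H'\<close>.  An explicit solution is known in both directions: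
  \<open>y m, s (m+1), y (m+1), \<dots>\<close> and \<open>t m, x (m-1), t (m-1), \<dots>\<close>, where now \<open>t\<close> stands for the
  sequence.  Admissibility gives the numerators of \<open>y\<close> and \<open>x\<close>, and likewise those of \<open>s\<close> and \<open>t\<close>,
  equal signs; as each denominator is the sum of the two numerators, all of these numbers lie strictly between 0 and 1.

  Let \<open>N\<close>, \<open>D\<close> be the numerators and denominators of the continued fraction of a chain sequence.
  Every family \<open>h\<close> of parameters satisfies
  \<open>N n - h 0 * D n = (\<Prod>k\<le>n. 1 - h k)\<close> (\<open>chain_cf_num_minus_den\<close>).  For a family \<open>g\<close> inside
  \<open>(0,1)\<close> this gives \<open>N n / D n = g 0 + (1 - g 0) / S n\<close> with
  \<open>S n = (\<Sum>j\<le>n. \<Prod>k=1..j. g k / (1 - g k))\<close>, a series introduced by Wall.  If it diverges, the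
  continued fraction converges to \<open>g 0\<close>; and since \<open>D n > 0\<close> and the product on the right is
  nonnegative for any \<open>h\<close> bounded by 1 with the same chain sequence, every such \<open>h\<close> has \<open>h 0 \<le> g 0\<close> (\<open>maximal_parameter\<close>).

  For the two explicit solutions, the \<open>k\<close>-th term of even index is of order \<open>k powr (2 * \<alpha> - 1)\<close>,
  so the series diverges because \<open>\<alpha> > 0\<close>.  Hence \<open>H = y 0\<close> and \<open>H' = q 0 / t 0 = y 0\<close>.
  For uniqueness, maximality gives \<open>L m (m-1) \<le> y m\<close> and \<open>U (m-1) (m-1) \<le> t m\<close> for every \<open>m\<close>,
  while the products of both sides equal \<open>q m > 0\<close>; so both inequalities are equalities.
\<close>

section \<open>Continued fractions whose partial numerators form a chain sequence\<close>

abbreviation chain_seq :: "(nat \<Rightarrow> real) \<Rightarrow> nat \<Rightarrow> real" where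
  "chain_seq g k \<equiv> (1 - g k) * g (Suc k)"

abbreviation chain_cf_num :: "(nat \<Rightarrow> real) \<Rightarrow> nat \<Rightarrow> real" where
  "chain_cf_num g \<equiv> cf_num 1 (\<lambda>k. - chain_seq g k) (\<lambda>_. 1)"

abbreviation chain_cf_den :: "(nat \<Rightarrow> real) \<Rightarrow> nat \<Rightarrow> real" where
  "chain_cf_den g \<equiv> cf_den (\<lambda>k. - chain_seq g k) (\<lambda>_. 1)"

text \<open>
  The terms of Wall's series.  The index is shifted because \<open>g 0\<close> does not enter the products.
\<close>

definition wall_term :: "(nat \<Rightarrow> real) \<Rightarrow> nat \<Rightarrow> real" where
  "wall_term g j = (\<Prod>k<j. g (Suc k) / (1 - g (Suc k)))"

text \<open>
  Both \<open>N\<close> and \<open>D\<close> solve \<open>X (n+2) = X (n+1) - (1 - h (n+1)) * h (n+2) * X n\<close>, and so does the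
  product on the right, whose quotients \<open>X (n+1) / X n\<close> are \<open>1 - h (n+1)\<close>.  The identity is used
  twice for one chain sequence: with explicit parameters and with unknown ones.
\<close>

lemma chain_cf_num_minus_den:
  "chain_cf_num h n - h 0 * chain_cf_den h n = (\<Prod>k\<le>n. 1 - h k)"
proof (induction n rule: induct_nat_012)
  case (ge2 n)
  have "chain_cf_num h (Suc (Suc n)) - h 0 * chain_cf_den h (Suc (Suc n)) =
      (chain_cf_num h (Suc n) - h 0 * chain_cf_den h (Suc n)) -
      chain_seq h (Suc n) * (chain_cf_num h n - h 0 * chain_cf_den h n)"
    by (simp add: algebra_simps)
  also have "\<dots> = (\<Prod>k\<le>Suc n. 1 - h k) - chain_seq h (Suc n) * (\<Prod>k\<le>n. 1 - h k)"
    unfolding ge2 ..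
  also have "\<dots> = (\<Prod>k\<le>Suc (Suc n). 1 - h k)"
    by (simp add: algebra_simps)
  finally show ?case .
qed (simp_all add: algebra_simps)

lemma chain_cf_den_Suc:
  "chain_cf_den g (Suc n) = (1 - g (Suc n)) * chain_cf_den g n + (\<Prod>k\<le>n. g (Suc k))"
proof (induction n)
  case (Suc n)
  let ?D = "chain_cf_den g" and ?G = "\<Prod>k\<le>n. g (Suc k)"
  have "?D (Suc (Suc n)) = ?D (Suc n) - g (Suc (Suc n)) * ((1 - g (Suc n)) * ?D n)"
    by (simp add: algebra_simps)
  also have "(1 - g (Suc n)) * ?D n = ?D (Suc n) - ?G"
    using Suc by linarith
  finally show ?case
    by (simp add: algebra_simps)
qed (simp add: algebra_simps)

text \<open>
  Reduction of order: \<open>\<Prod>k<n. 1 - g (Suc k)\<close> is one solution of the recurrence for the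
  denominators, and dividing by it leaves the partial sums of Wall's series.
\<close>

lemma chain_cf_den_eq:
  assumes "\<And>k. g k \<noteq> 1"
  shows "chain_cf_den g n = (\<Prod>k<n. 1 - g (Suc k)) * (\<Sum>j\<le>n. wall_term g j)"
proof (induction n)
  case 0
  show ?case by (simp add: wall_term_def)
next
  case (Suc n)
  have "(\<Prod>k\<le>n. g (Suc k)) = (\<Prod>k<Suc n. 1 - g (Suc k)) * wall_term g (Suc n)"
    unfolding wall_term_def prod.distrib[symmetric] lessThan_Suc_atMost[symmetric]
    by (intro prod.cong) (use assms in auto)
  then show ?case
    unfolding chain_cf_den_Suc Suc prod.lessThan_Suc sum.atMost_Suc by (simp only: algebra_simps)
qed

lemma not_summable_imp_partial_sums_at_top:
  fixes f :: "nat \<Rightarrow> real"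
  assumes "\<And>n. f n \<ge> 0" and "\<not> summable f"
  shows "filterlim (\<lambda>n. \<Sum>j\<le>n. f j) at_top sequentially"
proof (rule filterlim_at_top[THEN iffD2], rule allI)
  fix B :: real
  obtain n where n: "\<not> (\<Sum>i<n. f i) \<le> B"
    using summableI_nonneg_bounded[of f B] assms by blast
  have "(\<Sum>j\<le>m. f j) \<ge> B" if "m \<ge> n" for m
  proof -
    have "(\<Sum>i<n. f i) \<le> (\<Sum>j\<le>m. f j)"
      using that assms(1) by (intro sum_mono2) auto
    with n show ?thesis by linarith
  qed
  then show "\<forall>\<^sub>F m in sequentially. B \<le> (\<Sum>j\<le>m. f j)"
    by (auto simp: eventually_sequentially)
qed

locale divergent_chain =
  fixes g :: "nat \<Rightarrow> real"
  assumes pos: "g k > 0" and less_one: "g k < 1"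
    and divergent: "\<not> summable (wall_term g)"
begin

lemma wall_term_pos: "wall_term g j > 0"
  unfolding wall_term_def by (intro prod_pos) (simp add: pos less_one)

lemma chain_cf_den_pos: "chain_cf_den g n > 0"
proof -
  have "(\<Sum>j\<le>n. wall_term g j) > 0"
    by (intro sum_pos wall_term_pos) auto
  moreover have "(\<Prod>k<n. 1 - g (Suc k)) > 0"
    by (intro prod_pos) (simp add: less_one)
  ultimately show ?thesis
    using less_one by (subst chain_cf_den_eq) (auto simp: less_le)
qed

lemma chain_cf_num_pos: "chain_cf_num g n > 0"
proof -
  have "(\<Prod>k\<le>n. 1 - g k) > 0"
    by (intro prod_pos) (simp add: less_one)
  with chain_cf_num_minus_den[of g n] mult_pos_pos[OF pos[of 0] chain_cf_den_pos[of n]]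
  show ?thesis by linarith
qed

lemma chain_cf_convergent_eq:
  "chain_cf_num g n / chain_cf_den g n = g 0 + (1 - g 0) / (\<Sum>j\<le>n. wall_term g j)"
proof -
  let ?S = "\<Sum>j\<le>n. wall_term g j" and ?X = "\<Prod>k<n. 1 - g (Suc k)"
  have X: "?X > 0" by (intro prod_pos) (simp add: less_one)
  have S: "?S > 0" by (intro sum_pos wall_term_pos) auto
  have den: "chain_cf_den g n = ?X * ?S"
    using less_one by (intro chain_cf_den_eq) (auto simp: less_le)
  have "(\<Prod>k\<le>n. 1 - g k) = (1 - g 0) * ?X"
    by (simp only: lessThan_Suc_atMost[symmetric] prod.lessThan_Suc_shift)
  with chain_cf_num_minus_den[of g n]
  have num: "chain_cf_num g n = g 0 * (?X * ?S) + (1 - g 0) * ?X"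
    unfolding den by (simp only: diff_eq_eq add.commute)
  show ?thesis
    unfolding num den using X S by (simp add: add_divide_distrib less_imp_neq[symmetric])
qed

lemma chain_cf_tendsto: "(\<lambda>n. chain_cf_num g n / chain_cf_den g n) \<longlonglongrightarrow> g 0"
proof -
  have "(\<lambda>n. (1 - g 0) / (\<Sum>j\<le>n. wall_term g j)) \<longlonglongrightarrow> 0"
    by (intro real_tendsto_divide_at_top[OF tendsto_const] not_summable_imp_partial_sums_at_top
          divergent less_imp_le wall_term_pos)
  then show ?thesis
    unfolding chain_cf_convergent_eq using tendsto_add[OF tendsto_const] by fastforce
qed

text \<open>
  A family with the same chain sequence has the same convergents, and none of these lies below
  \<open>h 0\<close>; their limit is \<open>g 0\<close>.
\<close>

lemma maximal_parameter:
  assumes "\<And>k. chain_seq h k = chain_seq g k" and "\<And>k. h k \<le> 1"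
  shows "h 0 \<le> g 0"
proof (rule LIMSEQ_le_const[OF chain_cf_tendsto], intro exI allI impI)
  fix n :: nat
  have "(\<Prod>k\<le>n. 1 - h k) \<ge> 0"
    by (intro prod_nonneg) (simp add: assms(2))
  then have "chain_cf_num g n - h 0 * chain_cf_den g n \<ge> 0"
    using chain_cf_num_minus_den[of h n] by (simp add: assms(1))
  then show "h 0 \<le> chain_cf_num g n / chain_cf_den g n"
    using chain_cf_den_pos[of n] by (simp add: field_simps)
qed

end

definition interlace :: "(nat \<Rightarrow> real) \<Rightarrow> (nat \<Rightarrow> real) \<Rightarrow> nat \<Rightarrow> real" where
  "interlace a b k = (if even k then a (k div 2) else b (k div 2))"

lemma interlace_0 [simp]: "interlace a b 0 = a 0"
  by (simp add: interlace_def)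

lemma chain_seq_interlace:
  "chain_seq (interlace a b) k =
    interlace (\<lambda>j. (1 - a j) * b j) (\<lambda>j. (1 - b j) * a (Suc j)) k"
  by (simp add: interlace_def)

text \<open>
  Here the \<open>k\<close>-th term of even index is of order \<open>k powr (a1 + a2 - c1 - c2)\<close>, and a subseries of
  nonnegative terms suffices for divergence.  Two steps are combined into one because the
  quotients of consecutive terms follow different formulas for even and odd index, so that Raabe's
  limit need not exist for the whole series.
\<close>

lemma divergent_chain_interlace:
  assumes ab: "\<And>j. 0 < a j" "\<And>j. a j < 1" "\<And>j. 0 < b j" "\<And>j. b j < 1"
    and ratio: "\<And>j. b j / (1 - b j) * (a (Suc j) / (1 - a (Suc j))) =
      (real j + a1) * (real j + a2) / ((real j + c1) * (real j + c2))"
    and exponent: "c1 + c2 < a1 + a2 + 1"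
  shows "divergent_chain (interlace a b)"
proof
  let ?g = "interlace a b"
  let ?f = "\<lambda>k. wall_term ?g (2 * k)"
  show g: "0 < ?g k" "?g k < 1" for k
    by (simp_all add: interlace_def ab)
  have pos: "?f k > 0" for k
    unfolding wall_term_def by (intro prod_pos) (simp add: g)
  have step: "?f (Suc k) = ?f k * ((real k + a1) * (real k + a2) / ((real k + c1) * (real k + c2)))"
    for k
    unfolding ratio[symmetric] by (simp add: wall_term_def interlace_def)
  have "?f k / ?f (Suc k) = (real k + c1) * (real k + c2) / ((real k + a1) * (real k + a2))" for k
    using pos[of k] unfolding step by simp
  moreover have "(\<lambda>k. real k * ((real k + c1) * (real k + c2) / ((real k + a1) * (real k + a2)) - 1))
      \<longlonglongrightarrow> c1 + c2 - a1 - a2"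
    by real_asymp
  ultimately have "(\<lambda>k. real k * (?f k / ?f (Suc k) - 1)) \<longlonglongrightarrow> c1 + c2 - a1 - a2"
    by simp
  then have limsup: "limsup (\<lambda>k. ereal (real k * (?f k / ?f (Suc k) - 1))) = ereal (c1 + c2 - a1 - a2)"
    by (intro lim_imp_Limsup tendsto_ereal) auto
  have "limsup (\<lambda>k. ereal (real k * (?f k / ?f (Suc k) - 1))) < 1"
    unfolding limsup using exponent by (simp add: one_ereal_def)
  then have "\<not> summable ?f"
    by (intro raabes_test_divergence) (simp_all only: pos eventually_True)
  moreover have "summable ?f" if "summable (wall_term ?g)"
    using summable_reindex[OF that, of "\<lambda>k. 2 * k"]
    by (simp add: inj_on_def o_def wall_term_def prod_nonneg g less_imp_le)
  ultimately show "\<not> summable (wall_term ?g)" by blast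
qed


section \<open>The two chains of parameters\<close>

definition forward_chain :: "real \<Rightarrow> real \<Rightarrow> real \<Rightarrow> int \<Rightarrow> nat \<Rightarrow> real" where
  "forward_chain \<alpha> \<beta> t m =
     interlace (\<lambda>j. y_coeff \<alpha> \<beta> t (m + int j)) (\<lambda>j. s_coeff \<alpha> \<beta> t (m + int j + 1))"

definition backward_chain :: "real \<Rightarrow> real \<Rightarrow> real \<Rightarrow> int \<Rightarrow> nat \<Rightarrow> real" where
  "backward_chain \<alpha> \<beta> t m =
     interlace (\<lambda>j. t_coeff \<alpha> \<beta> t (m - int j)) (\<lambda>j. x_coeff \<alpha> \<beta> t (m - int j - 1))"


section \<open>Signs and factorization of the coefficients\<close>

text \<open>
  Each admissible interval places \<open>t\<close> so that the closed interval between \<open>- t - \<alpha>\<close> and \<open>- t - \<beta> - 1\<close>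
  contains no integer, and neither does the one between \<open>- t\<close> and \<open>- t - \<alpha> - \<beta>\<close>.
\<close>

lemma admissible_same_signs:
  assumes "admissible_pos \<alpha> \<beta> t"
  shows "0 < of_int n + t + \<alpha> \<and> 0 < of_int n + t + \<beta> + 1
        \<or> of_int n + t + \<alpha> < 0 \<and> of_int n + t + \<beta> + 1 < 0"
    and "0 < of_int n + t \<and> 0 < of_int n + t + \<alpha> + \<beta>
        \<or> of_int n + t < 0 \<and> of_int n + t + \<alpha> + \<beta> < 0"
proof -
  let ?I = "\<lambda>j a b. of_int j + a < t \<and> t < of_int j + b"
  have range: "0 < \<alpha>" "\<alpha> < 1" "-1 < \<beta>" "\<beta> < 0"
    using assms by (auto simp: admissible_pos_def)
  obtain j :: int where j:
    "\<beta> - \<alpha> + 1 > 0 \<and> \<alpha> > -\<beta> \<and> (?I j 0 (-\<beta>) \<or> ?I j (-\<alpha>) (-\<alpha>-\<beta>)) \<or>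
     \<beta> - \<alpha> + 1 > 0 \<and> \<alpha> < -\<beta> \<and> (?I j (-\<alpha>) 0 \<or> ?I j (-\<alpha>-\<beta>) (-\<beta>)) \<or>
     \<beta> - \<alpha> + 1 < 0 \<and> \<alpha> > -\<beta> \<and> (?I j 0 (-\<alpha>+1) \<or> ?I j (-\<beta>) (-\<alpha>-\<beta>+1)) \<or>
     \<beta> - \<alpha> + 1 < 0 \<and> \<alpha> < -\<beta> \<and> (?I j (-\<beta>-1) 0 \<or> ?I j (-\<alpha>-\<beta>) (-\<alpha>+1))"
    using assms unfolding admissible_pos_def by (auto simp: algebra_simps)
  \<comment> \<open>In every case the four expressions exceed \<open>n + j\<close> by amounts between -1 and 2, so all are
      positive for \<open>n + j \<ge> 1\<close> and negative for \<open>n + j \<le> -2\<close>.\<close>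
  consider "n + j \<ge> 1" | "n + j = 0" | "n + j = -1" | "n + j \<le> -2" by linarith
  then have "real_of_int n + real_of_int j \<ge> 1 \<or> real_of_int n + real_of_int j = 0
      \<or> real_of_int n + real_of_int j = -1 \<or> real_of_int n + real_of_int j \<le> -2"
    by cases linarith+
  with j range show "0 < of_int n + t + \<alpha> \<and> 0 < of_int n + t + \<beta> + 1
        \<or> of_int n + t + \<alpha> < 0 \<and> of_int n + t + \<beta> + 1 < 0"
    and "0 < of_int n + t \<and> 0 < of_int n + t + \<alpha> + \<beta>
        \<or> of_int n + t < 0 \<and> of_int n + t + \<alpha> + \<beta> < 0"
    by argo+
qed

lemma fraction_of_same_signs:
  fixes u v :: real
  assumes "0 < u \<and> 0 < v \<or> u < 0 \<and> v < 0" and "d = u + v"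
  shows "0 < u / d" and "u / d < 1"
  using assms by (auto simp: field_simps)

context
  fixes \<alpha> \<beta> t :: real
  assumes admissible: "admissible_pos \<alpha> \<beta> t"
begin

lemma denominators_nonzero:
  "2 * of_int n + 2 * t + \<alpha> + \<beta> \<noteq> 0" "2 * of_int n + 2 * t + \<alpha> + \<beta> + 1 \<noteq> 0"
  using admissible_same_signs[OF admissible, of n] by auto

lemma coeff_bounds:
  "0 < y_coeff \<alpha> \<beta> t n" "y_coeff \<alpha> \<beta> t n < 1" "0 < x_coeff \<alpha> \<beta> t n" "x_coeff \<alpha> \<beta> t n < 1"
  "0 < s_coeff \<alpha> \<beta> t n" "s_coeff \<alpha> \<beta> t n < 1" "0 < t_coeff \<alpha> \<beta> t n" "t_coeff \<alpha> \<beta> t n < 1"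
  unfolding y_coeff_def x_coeff_def s_coeff_def t_coeff_def
  by (rule fraction_of_same_signs(1,2)[where v = "of_int n + t + \<beta> + 1"]
        fraction_of_same_signs(1,2)[where v = "of_int n + t + \<alpha>"]
        fraction_of_same_signs(1,2)[where v = "of_int n + t"]
        fraction_of_same_signs(1,2)[where v = "of_int n + t + \<alpha> + \<beta>"],
      use admissible_same_signs[OF admissible, of n] in force, simp; fail)+

lemma coeff_complements:
  "x_coeff \<alpha> \<beta> t n = 1 - y_coeff \<alpha> \<beta> t n" "s_coeff \<alpha> \<beta> t n = 1 - t_coeff \<alpha> \<beta> t n"
  unfolding y_coeff_def x_coeff_def s_coeff_def t_coeff_def
  using denominators_nonzero[of n] by (simp_all add: field_simps)

text \<open>
  These are the entries of the product of the two claimed factors, and at the same time they exhibit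
  the coefficients of \<open>P\<close> as chain sequences.
\<close>

lemma P_coeff_factorization:
  "p_coeff \<alpha> \<beta> t n = x_coeff \<alpha> \<beta> t n * s_coeff \<alpha> \<beta> t (n + 1)"
  "q_coeff \<alpha> \<beta> t n = y_coeff \<alpha> \<beta> t n * t_coeff \<alpha> \<beta> t n"
  "r_coeff \<alpha> \<beta> t n = y_coeff \<alpha> \<beta> t n * s_coeff \<alpha> \<beta> t n + x_coeff \<alpha> \<beta> t n * t_coeff \<alpha> \<beta> t (n + 1)"
  unfolding p_coeff_def q_coeff_def r_coeff_def y_coeff_def x_coeff_def s_coeff_def t_coeff_def
  by (simp_all add: algebra_simps)


section \<open>Divergence of the two Wall series\<close>

lemma chain_seq_forward_chain:
  "chain_seq (forward_chain \<alpha> \<beta> t m) k =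
     interlace (\<lambda>j. p_coeff \<alpha> \<beta> t (m + int j)) (\<lambda>j. q_coeff \<alpha> \<beta> t (m + int j + 1)) k"
  unfolding forward_chain_def chain_seq_interlace
  by (simp add: interlace_def P_coeff_factorization coeff_complements ac_simps)

lemma chain_seq_backward_chain:
  "chain_seq (backward_chain \<alpha> \<beta> t m) k =
     interlace (\<lambda>j. p_coeff \<alpha> \<beta> t (m - int j - 1)) (\<lambda>j. q_coeff \<alpha> \<beta> t (m - int j - 1)) k"
  unfolding backward_chain_def chain_seq_interlace
  by (simp add: interlace_def P_coeff_factorization coeff_complements algebra_simps)

lemma coeff_ratios:
  "y_coeff \<alpha> \<beta> t n / (1 - y_coeff \<alpha> \<beta> t n) = (of_int n + t + \<alpha>) / (of_int n + t + \<beta> + 1)"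
  "x_coeff \<alpha> \<beta> t n / (1 - x_coeff \<alpha> \<beta> t n) = (of_int n + t + \<beta> + 1) / (of_int n + t + \<alpha>)"
  "s_coeff \<alpha> \<beta> t n / (1 - s_coeff \<alpha> \<beta> t n) = (of_int n + t + \<alpha> + \<beta>) / (of_int n + t)"
  "t_coeff \<alpha> \<beta> t n / (1 - t_coeff \<alpha> \<beta> t n) = (of_int n + t) / (of_int n + t + \<alpha> + \<beta>)"
proof -
  have swap: "1 - y_coeff \<alpha> \<beta> t n = x_coeff \<alpha> \<beta> t n" "1 - x_coeff \<alpha> \<beta> t n = y_coeff \<alpha> \<beta> t n"
    "1 - s_coeff \<alpha> \<beta> t n = t_coeff \<alpha> \<beta> t n" "1 - t_coeff \<alpha> \<beta> t n = s_coeff \<alpha> \<beta> t n"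
    by (simp_all add: coeff_complements)
  show "y_coeff \<alpha> \<beta> t n / (1 - y_coeff \<alpha> \<beta> t n) = (of_int n + t + \<alpha>) / (of_int n + t + \<beta> + 1)"
    "x_coeff \<alpha> \<beta> t n / (1 - x_coeff \<alpha> \<beta> t n) = (of_int n + t + \<beta> + 1) / (of_int n + t + \<alpha>)"
    "s_coeff \<alpha> \<beta> t n / (1 - s_coeff \<alpha> \<beta> t n) = (of_int n + t + \<alpha> + \<beta>) / (of_int n + t)"
    "t_coeff \<alpha> \<beta> t n / (1 - t_coeff \<alpha> \<beta> t n) = (of_int n + t) / (of_int n + t + \<alpha> + \<beta>)"
    unfolding swap unfolding y_coeff_def x_coeff_def s_coeff_def t_coeff_def
    using denominators_nonzero[of n] by simp_all
qed

text \<open>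
  The order of the terms has the exponent
  \<open>(z + 1 + \<alpha> + \<beta>) + (z + 1 + \<alpha>) - (z + 1) - (z + \<beta> + 2) = 2 * \<alpha> - 1\<close>, where \<open>z = m + t\<close>.
\<close>

lemma divergent_forward_chain: "divergent_chain (forward_chain \<alpha> \<beta> t m)"
  unfolding forward_chain_def
proof (rule divergent_chain_interlace)
  let ?z = "of_int m + t"
  fix j
  show "s_coeff \<alpha> \<beta> t (m + int j + 1) / (1 - s_coeff \<alpha> \<beta> t (m + int j + 1)) *
      (y_coeff \<alpha> \<beta> t (m + int (Suc j)) / (1 - y_coeff \<alpha> \<beta> t (m + int (Suc j)))) =
      (real j + (?z + 1 + \<alpha> + \<beta>)) * (real j + (?z + 1 + \<alpha>)) /
      ((real j + (?z + 1)) * (real j + (?z + \<beta> + 2)))"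
    unfolding coeff_ratios by (simp add: algebra_simps)
qed (use admissible in \<open>auto simp: coeff_bounds admissible_pos_def\<close>)

text \<open>
  Going down, the four linear factors are decreasing in \<open>j\<close>.  Changing all their signs leaves the
  quotient unchanged, and the exponent is again \<open>2 * \<alpha> - 1\<close>.
\<close>

lemma divergent_backward_chain: "divergent_chain (backward_chain \<alpha> \<beta> t m)"
  unfolding backward_chain_def
proof (rule divergent_chain_interlace)
  let ?z = "of_int m + t"
  fix j
  have "x_coeff \<alpha> \<beta> t (m - int j - 1) / (1 - x_coeff \<alpha> \<beta> t (m - int j - 1)) *
      (t_coeff \<alpha> \<beta> t (m - int (Suc j)) / (1 - t_coeff \<alpha> \<beta> t (m - int (Suc j)))) =
      ((- (real j + (- ?z - \<beta>))) * (- (real j + (1 - ?z)))) /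
      ((- (real j + (1 - ?z - \<alpha>))) * (- (real j + (1 - ?z - \<alpha> - \<beta>))))"
    unfolding coeff_ratios by (simp add: algebra_simps)
  then show "x_coeff \<alpha> \<beta> t (m - int j - 1) / (1 - x_coeff \<alpha> \<beta> t (m - int j - 1)) *
      (t_coeff \<alpha> \<beta> t (m - int (Suc j)) / (1 - t_coeff \<alpha> \<beta> t (m - int (Suc j)))) =
      (real j + (- ?z - \<beta>)) * (real j + (1 - ?z)) /
      ((real j + (1 - ?z - \<alpha>)) * (real j + (1 - ?z - \<alpha> - \<beta>)))"
    unfolding minus_mult_minus .
qed (use admissible in \<open>auto simp: coeff_bounds admissible_pos_def\<close>)


section \<open>Convergence of the two continued fractions\<close>

lemma H_num_eq: "H_num \<alpha> \<beta> t = (\<lambda>k. - chain_seq (forward_chain \<alpha> \<beta> t 0) k)"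
  unfolding chain_seq_forward_chain
  by (simp add: fun_eq_iff H_num_def interlace_def)

lemma H'_num_Suc_eq: "(\<lambda>k. H'_num \<alpha> \<beta> t (Suc k)) = (\<lambda>k. - chain_seq (backward_chain \<alpha> \<beta> t 0) k)"
  unfolding chain_seq_backward_chain
  by (auto simp: fun_eq_iff H'_num_def interlace_def algebra_simps minus_diff_commute[of _ 1] elim!: evenE oddE)

lemma H_convergence:
  shows "H_converges \<alpha> \<beta> t" and "H_val \<alpha> \<beta> t = y_coeff \<alpha> \<beta> t 0"
proof -
  interpret divergent_chain "forward_chain \<alpha> \<beta> t 0" by (rule divergent_forward_chain)
  have lim: "cf_convergent 1 (H_num \<alpha> \<beta> t) (\<lambda>_. 1) \<longlonglongrightarrow> y_coeff \<alpha> \<beta> t 0"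
    using chain_cf_tendsto by (simp add: cf_convergent_def[abs_def] H_num_eq forward_chain_def)
  have "cf_den (H_num \<alpha> \<beta> t) (\<lambda>_. 1) n \<noteq> 0" for n
    using chain_cf_den_pos[of n] by (simp add: H_num_eq)
  with lim show "H_converges \<alpha> \<beta> t"
    unfolding H_converges_def cf_converges_def by (auto simp: convergent_def)
  show "H_val \<alpha> \<beta> t = y_coeff \<alpha> \<beta> t 0"
    unfolding H_val_def cf_value_def by (rule limI[OF lim])
qed

text \<open>
  Beyond its first partial numerator \<open>q 0\<close>, this fraction is the one of the downward chain from 0.
  Its convergents are therefore \<open>q 0\<close> divided by those of that chain, which tend to
  \<open>t_coeff \<alpha> \<beta> t 0\<close>; and \<open>q 0 = y 0 * t 0\<close>.
\<close>

lemma H'_convergence: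
  shows "H'_converges \<alpha> \<beta> t" and "H'_val \<alpha> \<beta> t = y_coeff \<alpha> \<beta> t 0"
proof -
  interpret divergent_chain "backward_chain \<alpha> \<beta> t 0" by (rule divergent_backward_chain)
  let ?N = "chain_cf_num (backward_chain \<alpha> \<beta> t 0)" and ?D = "chain_cf_den (backward_chain \<alpha> \<beta> t 0)"
  have g0: "backward_chain \<alpha> \<beta> t 0 0 = t_coeff \<alpha> \<beta> t 0"
    by (simp add: backward_chain_def)
  have den: "cf_den (H'_num \<alpha> \<beta> t) (\<lambda>_. 1) (Suc n) = ?N n" for n
    unfolding cf_shift H'_num_Suc_eq ..
  have num: "cf_num 0 (H'_num \<alpha> \<beta> t) (\<lambda>_. 1) (Suc n) = q_coeff \<alpha> \<beta> t 0 * ?D n" for n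
    unfolding cf_shift H'_num_Suc_eq by (simp add: H'_num_def)
  have "(\<lambda>n. q_coeff \<alpha> \<beta> t 0 / (?N n / ?D n)) \<longlonglongrightarrow> q_coeff \<alpha> \<beta> t 0 / t_coeff \<alpha> \<beta> t 0"
    using chain_cf_tendsto coeff_bounds(7)[of 0] unfolding g0
    by (intro tendsto_divide tendsto_const) auto
  then have "(\<lambda>n. cf_convergent 0 (H'_num \<alpha> \<beta> t) (\<lambda>_. 1) (Suc n)) \<longlonglongrightarrow> y_coeff \<alpha> \<beta> t 0"
    using coeff_bounds(7)[of 0] unfolding cf_convergent_def num den
    by (simp add: P_coeff_factorization)
  then have lim: "cf_convergent 0 (H'_num \<alpha> \<beta> t) (\<lambda>_. 1) \<longlonglongrightarrow> y_coeff \<alpha> \<beta> t 0"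
    by (rule LIMSEQ_imp_Suc)
  have "cf_den (H'_num \<alpha> \<beta> t) (\<lambda>_. 1) n \<noteq> 0" for n
    using den chain_cf_num_pos by (cases n) (auto simp: less_le)
  with lim show "H'_converges \<alpha> \<beta> t"
    unfolding H'_converges_def cf_converges_def by (auto simp: convergent_def)
  show "H'_val \<alpha> \<beta> t = y_coeff \<alpha> \<beta> t 0"
    unfolding H'_val_def cf_value_def by (rule limI[OF lim])
qed

end


section \<open>Stochastic LU factorizations\<close>

lemma bi_mult_bidiagonal:
  assumes "lower_bidiagonal L" and "upper_bidiagonal U"
  shows "bi_mult L U i j =
    (if j = i + 1 then L i i * U i (i + 1)
     else if j = i then L i (i - 1) * U (i - 1) i + L i i * U i i
     else if j = i - 1 then L i (i - 1) * U (i - 1) (i - 1)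
     else 0)"
proof -
  have "bi_mult L U i j = (\<Sum>\<^sub>\<infinity>k\<in>{i - 1, i}. L i k * U k j)"
    unfolding bi_mult_def using assms(1)
    by (intro infsum_cong_neutral) (auto simp: lower_bidiagonal_def)
  also have "\<dots> = L i (i - 1) * U (i - 1) j + L i i * U i j"
    by simp
  also have "\<dots> = (if j = i + 1 then L i i * U i (i + 1)
     else if j = i then L i (i - 1) * U (i - 1) i + L i i * U i i
     else if j = i - 1 then L i (i - 1) * U (i - 1) (i - 1)
     else 0)"
    using assms(2) by (auto simp: upper_bidiagonal_def)
  finally show ?thesis .
qed

lemma stochastic_LU_exists:
  assumes "admissible_pos \<alpha> \<beta> t"
  shows "\<exists>L U. stochastic_LU (P_mat \<alpha> \<beta> t) L U \<and> L 0 (-1) = y_coeff \<alpha> \<beta> t 0"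
proof -
  define L :: bi_matrix where
    "L i j = (if j = i then x_coeff \<alpha> \<beta> t i else if j = i - 1 then y_coeff \<alpha> \<beta> t i else 0)" for i j
  define U :: bi_matrix where
    "U i j = (if j = i then t_coeff \<alpha> \<beta> t (i + 1)
              else if j = i + 1 then s_coeff \<alpha> \<beta> t (i + 1) else 0)" for i j
  have bidiagonal: "lower_bidiagonal L" "upper_bidiagonal U"
    by (auto simp: lower_bidiagonal_def upper_bidiagonal_def L_def U_def)
  have "P_mat \<alpha> \<beta> t = bi_mult L U"
    by (simp add: fun_eq_iff bi_mult_bidiagonal[OF bidiagonal] P_mat_def L_def U_def
          P_coeff_factorization[OF assms])
  moreover have "L i j \<ge> 0" "U i j \<ge> 0" for i j
    using coeff_bounds[OF assms] by (simp_all add: L_def U_def less_imp_le)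
  ultimately have "stochastic_LU (P_mat \<alpha> \<beta> t) L U"
    using bidiagonal by (simp add: stochastic_LU_def L_def U_def coeff_complements[OF assms])
  moreover have "L 0 (-1) = y_coeff \<alpha> \<beta> t 0"
    by (simp add: L_def)
  ultimately show ?thesis by blast
qed

text \<open>
  Applying maximality at every row \<open>n\<close>, in both directions, determines all entries at once without
  propagating the value at row 0 through the recurrences.
\<close>

lemma stochastic_LU_unique:
  assumes "admissible_pos \<alpha> \<beta> t" and LU: "stochastic_LU (P_mat \<alpha> \<beta> t) L U"
  shows "L n (n - 1) = y_coeff \<alpha> \<beta> t n" and "U (n - 1) (n - 1) = t_coeff \<alpha> \<beta> t n"
    and "L n n = x_coeff \<alpha> \<beta> t n" and "U (n - 1) n = s_coeff \<alpha> \<beta> t n"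
proof -
  have bidiagonal: "lower_bidiagonal L" "upper_bidiagonal U"
    and nonneg: "L i j \<ge> 0" "U i j \<ge> 0"
    and L_row: "L i i = 1 - L i (i - 1)" and U_row: "U i i = 1 - U i (i + 1)"
    and P_eq: "P_mat \<alpha> \<beta> t = bi_mult L U" for i j
    using LU by (auto simp: stochastic_LU_def eq_diff_eq add.commute)
  have p_eq: "p_coeff \<alpha> \<beta> t i = L i i * U i (i + 1)" for i
    using fun_cong[OF fun_cong[OF P_eq], of i "i + 1"]
    by (simp add: P_mat_def bi_mult_bidiagonal[OF bidiagonal])
  have q_eq: "q_coeff \<alpha> \<beta> t i = L i (i - 1) * U (i - 1) (i - 1)" for i
    using fun_cong[OF fun_cong[OF P_eq], of i "i - 1"]
    by (simp add: P_mat_def bi_mult_bidiagonal[OF bidiagonal])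
  have forward: "(1 - L i (i - 1)) * U i (i + 1) = p_coeff \<alpha> \<beta> t i"
    "(1 - U i (i + 1)) * L (i + 1) i = q_coeff \<alpha> \<beta> t (i + 1)" for i
    unfolding p_eq q_eq using L_row[of i] U_row[of i] by simp_all
  have backward: "(1 - U i i) * L i i = p_coeff \<alpha> \<beta> t i"
    "(1 - L i i) * U (i - 1) (i - 1) = q_coeff \<alpha> \<beta> t i" for i
    unfolding p_eq q_eq using L_row[of i] U_row[of i] by simp_all
  have le_1: "L i (i - 1) \<le> 1" "U i (i + 1) \<le> 1" "U i i \<le> 1" "L i i \<le> 1" for i
    using nonneg[of i i] nonneg(1)[of i "i - 1"] nonneg(2)[of i "i + 1"] L_row[of i] U_row[of i]
    by linarith+
  have L_le: "L n (n - 1) \<le> y_coeff \<alpha> \<beta> t n"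
  proof -
    interpret divergent_chain "forward_chain \<alpha> \<beta> t n"
      by (rule divergent_forward_chain[OF assms(1)])
    let ?h = "interlace (\<lambda>j. L (n + int j) (n + int j - 1)) (\<lambda>j. U (n + int j) (n + int j + 1))"
    have "chain_seq ?h k = chain_seq (forward_chain \<alpha> \<beta> t n) k" for k
      unfolding chain_seq_interlace chain_seq_forward_chain[OF assms(1)] interlace_def
      using forward[of "n + int (k div 2)"] by (simp add: ac_simps)
    moreover have "?h k \<le> 1" for k
      by (simp add: interlace_def le_1)
    ultimately have "?h 0 \<le> forward_chain \<alpha> \<beta> t n 0"
      by (rule maximal_parameter)
    then show ?thesis
      by (simp add: forward_chain_def)
  qed
  have U_le: "U (n - 1) (n - 1) \<le> t_coeff \<alpha> \<beta> t n"
  proof -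
    interpret divergent_chain "backward_chain \<alpha> \<beta> t n"
      by (rule divergent_backward_chain[OF assms(1)])
    let ?h = "interlace (\<lambda>j. U (n - int j - 1) (n - int j - 1)) (\<lambda>j. L (n - int j - 1) (n - int j - 1))"
    have "chain_seq ?h k = chain_seq (backward_chain \<alpha> \<beta> t n) k" for k
      unfolding chain_seq_interlace chain_seq_backward_chain[OF assms(1)] interlace_def
      using backward[of "n - int (k div 2) - 1"] by (simp add: diff_diff_eq ac_simps)
    moreover have "?h k \<le> 1" for k
      by (simp add: interlace_def le_1)
    ultimately have "?h 0 \<le> backward_chain \<alpha> \<beta> t n 0"
      by (rule maximal_parameter)
    then show ?thesis
      by (simp add: backward_chain_def)
  qed
  have q: "L n (n - 1) * U (n - 1) (n - 1) = y_coeff \<alpha> \<beta> t n * t_coeff \<alpha> \<beta> t n"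
    using q_eq[of n] P_coeff_factorization(2)[OF assms(1)] by simp
  note pos = coeff_bounds(1)[OF assms(1), of n] coeff_bounds(7)[OF assms(1), of n]
  have "y_coeff \<alpha> \<beta> t n * t_coeff \<alpha> \<beta> t n \<le> L n (n - 1) * t_coeff \<alpha> \<beta> t n"
    unfolding q[symmetric] by (intro mult_left_mono U_le nonneg)
  with L_le pos show L: "L n (n - 1) = y_coeff \<alpha> \<beta> t n"
    by (simp add: mult_le_cancel_right)
  with q pos show U: "U (n - 1) (n - 1) = t_coeff \<alpha> \<beta> t n"
    by simp
  show "L n n = x_coeff \<alpha> \<beta> t n" "U (n - 1) n = s_coeff \<alpha> \<beta> t n"
    using L U L_row[of n] U_row[of "n - 1"] coeff_complements[OF assms(1), of n] by simp_all
qed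


section \<open>The factorization theorem\<close>

theorem theorem4p2:
  fixes \<alpha> \<beta> t :: real
  assumes "admissible_pos \<alpha> \<beta> t"
  shows "H_converges \<alpha> \<beta> t \<and> H'_converges \<alpha> \<beta> t
    \<and> H_val \<alpha> \<beta> t = H'_val \<alpha> \<beta> t
    \<and> H'_val \<alpha> \<beta> t = (\<alpha> + t) / (\<alpha> + \<beta> + 2 * t + 1)
    \<and> (\<forall>\<tau>. (\<exists>L U. stochastic_LU (P_mat \<alpha> \<beta> t) L U \<and> L 0 (-1) = \<tau>) \<longleftrightarrow> \<tau> = H_val \<alpha> \<beta> t)
    \<and> (\<forall>L U. stochastic_LU (P_mat \<alpha> \<beta> t) L U \<longrightarrow>
         (\<forall>n. U n n = t_coeff \<alpha> \<beta> t (n + 1)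
            \<and> U n (n + 1) = s_coeff \<alpha> \<beta> t (n + 1)
            \<and> L n n = x_coeff \<alpha> \<beta> t n
            \<and> L n (n - 1) = y_coeff \<alpha> \<beta> t n))"
proof (intro conjI allI impI)
  note H = H_convergence[OF assms] and H' = H'_convergence[OF assms]
  show "H_converges \<alpha> \<beta> t" "H'_converges \<alpha> \<beta> t" "H_val \<alpha> \<beta> t = H'_val \<alpha> \<beta> t"
    using H H' by simp_all
  show "H'_val \<alpha> \<beta> t = (\<alpha> + t) / (\<alpha> + \<beta> + 2 * t + 1)"
    unfolding H' y_coeff_def by (simp add: algebra_simps)
  show "(\<exists>L U. stochastic_LU (P_mat \<alpha> \<beta> t) L U \<and> L 0 (-1) = \<tau>) \<longleftrightarrow> \<tau> = H_val \<alpha> \<beta> t" for \<tau>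
    unfolding H
    using stochastic_LU_exists[OF assms] stochastic_LU_unique(1)[OF assms, of _ _ 0] by auto
  fix L U :: bi_matrix and n :: int
  assume LU: "stochastic_LU (P_mat \<alpha> \<beta> t) L U"
  show "U n n = t_coeff \<alpha> \<beta> t (n + 1)" "U n (n + 1) = s_coeff \<alpha> \<beta> t (n + 1)"
    using stochastic_LU_unique(2,4)[OF assms LU, of "n + 1"] by simp_all
  show "L n n = x_coeff \<alpha> \<beta> t n" "L n (n - 1) = y_coeff \<alpha> \<beta> t n"
    using stochastic_LU_unique(3,1)[OF assms LU, of n] by simp_all
qed

end
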